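(* Let $Y$ be a walk regular graph and let $X=Y^f$ be an abelian 2ev-cover of $Y$. Then $X$ is walk regular.
   Context: All graphs are finite, simple and undirected; the base graph $Y=(V,E)$ is connected. Covers: let $G$ be a permutation group on $R=\{1,\dots,r\}$. A symmetric arc function is a function $f:V\times V\to G\cup\{0\}$ such that $f(u,v)=0$ if and only if $\{u,v\}\notin E$, and $f(u,v)=f(v,u)^{-1}$ whenever $f(u,v)\in G$. The cover $Y^f$ (of index $r$, or $r$-fold) is the graph with vertex set $V\times R$ in which $(v,j)$ is adjacent to $(u,k)$ exactly when $v$ is adjacent to $u$ in $Y$ and $f(u,v)j=k$. The function $f$ is normalized if $f(u,v)=\mathrm{id}$ for all edges $\{u,v\}$ of some spanning tree of $Y$. Denote by $\langle f\rangle$ the subgroup of $\mathrm{Sym}(r)$ generated by the (non-zero) values of $f$. Standing assumptions: $f$ is normalized and $\langle f\rangle$ acts regularly (i.e. simply transitively) on $\{1,\dots,r\}$. The cover is called abelian if $\langle f\rangle$ is an abelian group. Two-eigenvalue cover (2ev-cover): $\mathrm{Spec}(A)$ denotes the spectrum of $A$ as a multiset, and $A(\cdot)$ the adjacency matrix. One has $\mathrm{Spec}(A(Y))\subseteq\mathrm{Spec}(A(Y^f))$ as multisets, and $Y^f$ is a 2ev-cover of $Y$ if the multiset difference $\mathrm{Spec}(A(Y^f))\setminus\mathrm{Spec}(A(Y))$ has exactly two distinct elements. A graph with adjacency matrix $A$ is walk regular if $A^k$ has constant diagonal for every positive integer $k$. *)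

theory Defs
  imports
    "Jordan_Normal_Form.Char_Poly"
    "Graph_Theory.Graph_Theory"
    "HOL-Algebra.Sym_Groups"
begin

text \<open>
  A finite simple undirected graph is a \<open>pair_graph\<close>: an undirected edge \<open>{u, v}\<close> is represented
  by the two arcs \<open>(u, v)\<close> and \<open>(v, u)\<close>.

  The constant \<open>spanning_tree\<close> of \<open>Graph_Theory\<close> is not used: its acyclicity is about directed
  cycles, and there \<open>a, b, a\<close> counts as a cycle of a symmetric digraph. In a \<open>pair_graph\<close>, the
  cycles with at least three arcs are exactly the cycles of the undirected graph.
\<close>

definition undirected_tree :: "'v pair_pre_digraph \<Rightarrow> bool" where
  "undirected_tree T \<longleftrightarrow> pair_graph T \<and> Digraph_Component.connected (with_proj T) \<and>
     \<not> (\<exists>p. pre_digraph.cycle (with_proj T) p \<and> 3 \<le> length p)"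

definition undirected_spanning_tree :: "'v pair_pre_digraph \<Rightarrow> 'v pair_pre_digraph \<Rightarrow> bool" where
  "undirected_spanning_tree T Y \<longleftrightarrow>
     undirected_tree T \<and> Digraph_Component.spanning (with_proj T) (with_proj Y)"

text \<open>
  The values of an arc function live in \<open>G \<union> {0}\<close>; the extra element \<open>0\<close> is \<open>None\<close>.
  Permutations of \<open>{1..r}\<close> are the elements of \<open>sym_group r\<close>, i.e. functions on \<open>nat\<close> that fix
  everything outside \<open>{1..r}\<close>, so that the identity permutation is \<open>id\<close>.
\<close>

type_synonym 'v arc_function = "'v \<Rightarrow> 'v \<Rightarrow> (nat \<Rightarrow> nat) option"

definition symmetric_arc_function ::
  "'v pair_pre_digraph \<Rightarrow> nat \<Rightarrow> (nat \<Rightarrow> nat) set \<Rightarrow> 'v arc_function \<Rightarrow> bool" where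
  "symmetric_arc_function Y r G f \<longleftrightarrow>
     (\<forall>u \<in> pverts Y. \<forall>v \<in> pverts Y.
        (f u v = None \<longleftrightarrow> (u, v) \<notin> parcs Y) \<and>
        (\<forall>g. f u v = Some g \<longrightarrow> g \<in> G \<and> f v u = Some (inv\<^bsub>sym_group r\<^esub> g)))"

definition normalized :: "'v pair_pre_digraph \<Rightarrow> 'v arc_function \<Rightarrow> bool" where
  "normalized Y f \<longleftrightarrow>
     (\<exists>T. undirected_spanning_tree T Y \<and> (\<forall>(u, v) \<in> parcs T. f u v = Some id))"

definition arc_function_group ::
  "'v pair_pre_digraph \<Rightarrow> nat \<Rightarrow> 'v arc_function \<Rightarrow> (nat \<Rightarrow> nat) set" where
  "arc_function_group Y r f =
     generate (sym_group r) {g. \<exists>u \<in> pverts Y. \<exists>v \<in> pverts Y. f u v = Some g}"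

definition acts_regularly :: "(nat \<Rightarrow> nat) set \<Rightarrow> nat \<Rightarrow> bool" where
  "acts_regularly H r \<longleftrightarrow> (\<forall>i \<in> {1..r}. \<forall>j \<in> {1..r}. \<exists>!g. g \<in> H \<and> g i = j)"

definition cover ::
  "'v pair_pre_digraph \<Rightarrow> nat \<Rightarrow> 'v arc_function \<Rightarrow> ('v \<times> nat) pair_pre_digraph" where
  "cover Y r f =
     \<lparr> pverts = pverts Y \<times> {1..r},
       parcs = {((v, j), (u, k)) | v j u k.
                  j \<in> {1..r} \<and> k \<in> {1..r} \<and> (v, u) \<in> parcs Y \<and>
                  (\<exists>g. f u v = Some g \<and> g j = k)} \<rparr>"

definition abelian_cover :: "'v pair_pre_digraph \<Rightarrow> nat \<Rightarrow> 'v arc_function \<Rightarrow> bool" where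
  "abelian_cover Y r f \<longleftrightarrow> comm_group (sym_group r \<lparr> carrier := arc_function_group Y r f \<rparr>)"

text \<open>
  Matrices of \<open>Jordan_Normal_Form\<close> are indexed by initial segments of \<open>nat\<close>, so the adjacency
  matrix is taken with respect to an arbitrary enumeration of the vertices. A different
  enumeration conjugates the matrix by a permutation matrix, which affects neither the spectrum
  nor whether the powers have constant diagonal.
\<close>

definition vertex_list :: "'v pair_pre_digraph \<Rightarrow> 'v list" where
  "vertex_list Y = (SOME vs. distinct vs \<and> set vs = pverts Y)"

definition adjacency_matrix :: "'v pair_pre_digraph \<Rightarrow> complex mat" where
  "adjacency_matrix Y =
     (let vs = vertex_list Y; n = length vs
      in mat n n (\<lambda>(i, j). if (vs ! i, vs ! j) \<in> parcs Y then 1 else 0))"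

text \<open>
  Over the complex numbers the characteristic polynomial splits, so this multiset contains every
  eigenvalue with its full algebraic multiplicity.
\<close>

definition Spec :: "complex mat \<Rightarrow> complex multiset" where
  "Spec A = proots (char_poly A)"

definition two_ev_cover :: "'v pair_pre_digraph \<Rightarrow> nat \<Rightarrow> 'v arc_function \<Rightarrow> bool" where
  "two_ev_cover Y r f \<longleftrightarrow>
     card (set_mset (Spec (adjacency_matrix (cover Y r f)) - Spec (adjacency_matrix Y))) = 2"

definition walk_regular :: "'v pair_pre_digraph \<Rightarrow> bool" where
  "walk_regular Y \<longleftrightarrow>
     (\<forall>k > 0. \<exists>c. \<forall>i < dim_row (adjacency_matrix Y). (adjacency_matrix Y ^\<^sub>m k) $$ (i, i) = c)"

end

theory Submission
  imports Defs "Jordan_Normal_Form.Schur_Decomposition"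
begin

text \<open>
  Let \<open>Q\<close> be the matrix that pulls functions on the vertices of \<open>Y\<close> back to the cover, so that
  \<open>M Q = Q A\<close> for the adjacency matrices \<open>M\<close> of the cover and \<open>A\<close> of \<open>Y\<close>, and \<open>Q\<^sup>* Q = r\<close>. Then
  \<open>R = r - Q Q\<^sup>*\<close> commutes with \<open>M\<close>, and for every polynomial \<open>p\<close> the squared Frobenius norm of
  \<open>p(M) R\<close> is \<open>r\<^sup>2\<close> times the difference of the sums of \<open>\<bar>p\<bar>\<^sup>2\<close> over the spectra of \<open>M\<close> and \<open>A\<close>. If
  only two eigenvalues \<open>\<theta>\<close>, \<open>\<tau>\<close> are new, this gives \<open>(M - \<theta>)(M - \<tau>) R = 0\<close>, hence
  \<open>M^k R = a M R + b R\<close>. On the diagonal this expresses \<open>r M^k\<close> through the diagonals of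
  \<open>A^k\<close>, \<open>M\<close>, \<open>A\<close> and constants; those of \<open>M\<close> and \<open>A\<close> vanish.
\<close>

subsection \<open>Traces of polynomials in a matrix\<close>

definition tr :: "'a :: comm_monoid_add mat \<Rightarrow> 'a" where
  "tr A = (\<Sum>i<dim_row A. A $$ (i, i))"

definition adj :: "complex mat \<Rightarrow> complex mat" where
  "adj A = map_mat cnj (transpose_mat A)"

text \<open>A monic polynomial is encoded by the list of its roots and evaluated at \<open>M\<close>
  factor by factor. Multiplying polynomials becomes concatenating lists, and conjugating the
  coefficients becomes conjugating the roots.\<close>

fun root_prod :: "'a :: comm_ring_1 list \<Rightarrow> 'a mat \<Rightarrow> 'a mat" where
  "root_prod [] M = 1\<^sub>m (dim_row M)"
| "root_prod (l # ls) M = (M - l \<cdot>\<^sub>m 1\<^sub>m (dim_row M)) * root_prod ls M"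

lemma index_mult_mat_sum:
  assumes "A \<in> carrier_mat n m" "B \<in> carrier_mat m k" "i < n" "j < k"
  shows "(A * B) $$ (i, j) = (\<Sum>l<m. A $$ (i, l) * B $$ (l, j))"
  using assms by (auto simp: scalar_prod_def atLeast0LessThan intro!: sum.cong)

lemma tr_comm:
  fixes A B :: "'a :: comm_semiring_0 mat"
  assumes "A \<in> carrier_mat n m" "B \<in> carrier_mat m n"
  shows "tr (A * B) = tr (B * A)"
proof -
  have "tr (A * B) = (\<Sum>i<n. \<Sum>j<m. A $$ (i, j) * B $$ (j, i))"
    using assms by (auto simp: tr_def scalar_prod_def atLeast0LessThan intro!: sum.cong)
  also have "\<dots> = (\<Sum>j<m. \<Sum>i<n. B $$ (j, i) * A $$ (i, j))"
    by (subst sum.swap) (simp add: mult.commute)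
  also have "\<dots> = tr (B * A)"
    using assms by (auto simp: tr_def scalar_prod_def atLeast0LessThan intro!: sum.cong)
  finally show ?thesis .
qed

lemma tr_minus:
  fixes A B :: "'a :: ab_group_add mat"
  assumes "A \<in> carrier_mat n n" "B \<in> carrier_mat n n"
  shows "tr (A - B) = tr A - tr B"
  using assms by (simp add: tr_def sum_subtractf)

lemma tr_smult:
  fixes A :: "'a :: semiring_0 mat"
  assumes "A \<in> carrier_mat n n"
  shows "tr (c \<cdot>\<^sub>m A) = c * tr A"
  using assms by (simp add: tr_def sum_distrib_left)

section \<open>Conjugate transpose and Frobenius norm\<close>

lemma adj_carrier [simp]: "adj A \<in> carrier_mat n m \<longleftrightarrow> A \<in> carrier_mat m n"
  by (simp add: adj_def)

lemma adj_dim [simp]: "dim_row (adj A) = dim_col A" "dim_col (adj A) = dim_row A"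
  by (simp_all add: adj_def)

lemma adj_index [simp]: "i < dim_col A \<Longrightarrow> j < dim_row A \<Longrightarrow> adj A $$ (i, j) = cnj (A $$ (j, i))"
  by (simp add: adj_def)

lemma adj_adj [simp]: "adj (adj A) = A"
  by (intro eq_matI) auto

lemma adj_one [simp]: "adj (1\<^sub>m n) = 1\<^sub>m n"
  by (intro eq_matI) auto

lemma adj_mult:
  assumes "A \<in> carrier_mat n m" "B \<in> carrier_mat m k"
  shows "adj (A * B) = adj B * adj A"
  using assms by (intro eq_matI) (auto simp: scalar_prod_def mult.commute)

lemma adj_minus:
  assumes "A \<in> carrier_mat n m" "B \<in> carrier_mat n m"
  shows "adj (A - B) = adj A - adj B"
  using assms by (intro eq_matI) auto

lemma adj_smult: "adj (c \<cdot>\<^sub>m A) = cnj c \<cdot>\<^sub>m adj A"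
  by (intro eq_matI) auto

lemma tr_adj_mult_self:
  assumes "A \<in> carrier_mat n m"
  shows "tr (adj A * A) = of_real (\<Sum>j<m. \<Sum>i<n. (cmod (A $$ (i, j)))\<^sup>2)"
proof -
  have "cnj z * z = of_real ((cmod z)\<^sup>2)" for z
    using complex_norm_square[of z] by (simp add: mult.commute)
  then show ?thesis
    using assms
    by (auto simp: tr_def scalar_prod_def atLeast0LessThan intro!: sum.cong)
qed

text \<open>The trace is the squared Frobenius norm, which is definite. This turns an identity
  between traces into an identity between matrices.\<close>

lemma tr_adj_mult_self_eq_0:
  assumes A: "A \<in> carrier_mat n m" and 0: "tr (adj A * A) = 0"
  shows "A = 0\<^sub>m n m"
proof -
  have "(\<Sum>j<m. \<Sum>i<n. (cmod (A $$ (i, j)))\<^sup>2) = 0"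
    using 0 unfolding tr_adj_mult_self[OF A] of_real_eq_0_iff .
  then have "\<forall>j<m. \<forall>i<n. A $$ (i, j) = 0"
    by (auto simp: sum_nonneg_eq_0_iff sum_nonneg)
  then show ?thesis
    using A by (intro eq_matI) auto
qed

section \<open>Polynomials given by their roots\<close>

lemma root_prod_carrier [simp]: "M \<in> carrier_mat n n \<Longrightarrow> root_prod ls M \<in> carrier_mat n n"
  by (induction ls) (auto intro!: mult_carrier_mat)

lemma root_prod_dim [simp]:
  assumes "M \<in> carrier_mat n n"
  shows "dim_row (root_prod ls M) = n" "dim_col (root_prod ls M) = n"
  using root_prod_carrier[OF assms] by (rule carrier_matD)+

lemma root_prod_append:
  assumes "M \<in> carrier_mat n n"
  shows "root_prod (ls @ ks) M = root_prod ls M * root_prod ks M"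
proof (induction ls)
  case Nil
  then show ?case using assms by (simp add: left_mult_one_mat[of _ n n])
next
  case (Cons l ls)
  let ?M = "M - l \<cdot>\<^sub>m 1\<^sub>m n"
  have "?M * root_prod ls M * root_prod ks M = ?M * (root_prod ls M * root_prod ks M)"
    using assms by (intro assoc_mult_mat[of _ n n _ n _ n]) auto
  then show ?case using Cons.IH assms by simp
qed

text \<open>Each linear factor passes through \<open>Q\<close>: \<open>M - l\<close> on the left
  becomes \<open>A - l\<close> on the right. Three instances occur later: triangularisation, pulling
  back from the base, and commutation of \<open>R\<close> with polynomials in
  \<open>M\<close>.\<close>

lemma root_prod_intertwine:
  assumes M: "M \<in> carrier_mat n n" and A: "A \<in> carrier_mat m m" and Q: "Q \<in> carrier_mat n m"
    and MQ: "M * Q = Q * A"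
  shows "root_prod ls M * Q = Q * root_prod ls A"
proof (induction ls)
  case Nil
  then show ?case using assms by simp
next
  case (Cons l ls)
  let ?M = "M - l \<cdot>\<^sub>m 1\<^sub>m n" and ?A = "A - l \<cdot>\<^sub>m 1\<^sub>m m"
  have carr: "?M \<in> carrier_mat n n" "?A \<in> carrier_mat m m"
    using M A by auto
  have "?M * Q = Q * ?A"
    using M A Q MQ
    by (simp add: minus_mult_distrib_mat[of _ n n _ _ m] mult_minus_distrib_mat[of _ n m _ m]
        mult_smult_assoc_mat[of _ n n _ m] mult_smult_distrib[of _ n m _ m])
  moreover have "?M * root_prod ls M * Q = ?M * (root_prod ls M * Q)"
    using carr M Q by (intro assoc_mult_mat) auto
  moreover have "?M * (Q * root_prod ls A) = ?M * Q * root_prod ls A"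
    using carr A Q by (intro assoc_mult_mat[symmetric, of _ n n _ m _ m]) auto
  moreover have "Q * ?A * root_prod ls A = Q * (?A * root_prod ls A)"
    using carr A Q by (intro assoc_mult_mat[of _ n m _ m _ m]) auto
  ultimately show ?case
    using Cons.IH M A by simp
qed

lemma adj_root_prod:
  assumes M: "M \<in> carrier_mat n n" and herm: "adj M = M"
  shows "adj (root_prod ls M) = root_prod (rev (map cnj ls)) M"
proof (induction ls)
  case Nil
  then show ?case using M by simp
next
  case (Cons l ls)
  let ?M = "M - l \<cdot>\<^sub>m 1\<^sub>m n"
  have "adj (root_prod (l # ls) M) = adj (root_prod ls M) * adj ?M"
    using M by (simp add: adj_mult[of ?M n n "root_prod ls M" n] minus_carrier_mat)
  also have "adj ?M = root_prod [cnj l] M"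
    using M herm by (simp add: adj_minus[of _ n n] adj_smult)
  finally show ?case
    using M Cons.IH by (simp add: root_prod_append del: root_prod.simps)
qed

text \<open>Diagonal entries multiply only because both factors are upper triangular, so the two
  claims share one induction.\<close>

lemma root_prod_upper_triangular:
  assumes T: "T \<in> carrier_mat n n" and ut: "upper_triangular T"
  shows "upper_triangular (root_prod ls T) \<and>
    (\<forall>i<n. root_prod ls T $$ (i, i) = (\<Prod>l\<leftarrow>ls. T $$ (i, i) - l))"
proof (induction ls)
  case Nil
  then show ?case using T by (auto simp: upper_triangular_def)
next
  case (Cons l ls)
  let ?T = "T - l \<cdot>\<^sub>m 1\<^sub>m n" and ?B = "root_prod ls T"
  have B: "?B \<in> carrier_mat n n" using T by simp
  have idx: "(?T * ?B) $$ (i, j) = (\<Sum>k<n. ?T $$ (i, k) * ?B $$ (k, j))" if "i < n" "j < n" for i j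
    using that T B by (intro index_mult_mat_sum[of _ n n _ n]) auto
  have T0: "?T $$ (i, k) = 0" if "k < i" "i < n" for i k
    using that T ut by (auto simp: upper_triangular_def)
  have B0: "?B $$ (i, k) = 0" if "k < i" "i < n" for i k
    using that B Cons.IH by (auto simp: upper_triangular_def)
  have "(?T * ?B) $$ (i, j) = 0" if "j < i" "i < n" for i j
  proof -
    have "?T $$ (i, k) * ?B $$ (k, j) = 0" if "k < n" for k
      using T0[of k i] B0[of j k] \<open>j < i\<close> \<open>i < n\<close> that by (cases "k < i") auto
    then show ?thesis using idx[of i j] that by simp
  qed
  moreover have "(?T * ?B) $$ (i, i) = (T $$ (i, i) - l) * (\<Prod>l\<leftarrow>ls. T $$ (i, i) - l)" if i: "i < n" for i
  proof -
    have "?T $$ (i, k) * ?B $$ (k, i) = (if k = i then ?T $$ (i, i) * ?B $$ (i, i) else 0)"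
      if "k < n" for k
      using T0[of k i] B0[of i k] i that by (cases k i rule: linorder_cases) auto
    then have "(\<Sum>k<n. ?T $$ (i, k) * ?B $$ (k, i)) =
        (\<Sum>k<n. if k = i then ?T $$ (i, i) * ?B $$ (i, i) else 0)"
      by (intro sum.cong) auto
    then have "(?T * ?B) $$ (i, i) = ?T $$ (i, i) * ?B $$ (i, i)"
      unfolding idx[OF i i] using i by (simp add: sum.delta del: index_minus_mat)
    then show ?thesis using i T Cons.IH by simp
  qed
  ultimately show ?case
    using T by (auto simp: upper_triangular_def)
qed

text \<open>By Schur decomposition \<open>M\<close> is similar to an upper triangular matrix
  \<open>T\<close> whose diagonal lists the eigenvalues with multiplicity. The polynomial is moved
  to \<open>T\<close>, where its trace can be read off, and similarity preserves the trace.\<close>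

lemma tr_root_prod:
  fixes M :: "complex mat"
  assumes M: "M \<in> carrier_mat n n"
  shows "tr (root_prod ls M) = (\<Sum>x\<in>#Spec M. \<Prod>l\<leftarrow>ls. x - l)"
proof -
  obtain es where es: "char_poly M = (\<Prod>e\<leftarrow>es. [:- e, 1:])"
    using char_poly_factorized[OF M] by blast
  obtain T P Q where "schur_decomposition M es = (T, P, Q)"
    by (cases "schur_decomposition M es")
  from schur_decomposition[OF M es this]
  have sim: "similar_mat_wit M T P Q" and ut: "upper_triangular T" and diag: "diag_mat T = es"
    by auto
  note sim = similar_mat_witD2[OF M sim]
  have "Spec M = mset es"
    unfolding Spec_def es by (subst proots_prod_list[of "map _ _", simplified]) (auto simp: o_def)
  have "M * P = P * T * (Q * P)"
    using sim by (simp add: assoc_mult_mat[of _ n n _ n _ n])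
  then have "M * P = P * T"
    using sim by simp
  then have inter: "root_prod ls M * P = P * root_prod ls T"
    using sim by (intro root_prod_intertwine) auto
  have "tr (root_prod ls M) = tr (root_prod ls M * (P * Q))"
    using sim M by simp
  also have "\<dots> = tr (P * root_prod ls T * Q)"
    using sim by (subst inter[symmetric], subst assoc_mult_mat[of _ n n _ n _ n]) auto
  also have "\<dots> = tr (Q * (P * root_prod ls T))"
    using sim by (intro tr_comm[of _ n n]) auto
  also have "Q * (P * root_prod ls T) = Q * P * root_prod ls T"
    using sim by (intro assoc_mult_mat[symmetric, of _ n n _ n _ n]) auto
  also have "\<dots> = root_prod ls T"
    using sim by simp
  also have "tr \<dots> = (\<Sum>i<n. \<Prod>l\<leftarrow>ls. T $$ (i, i) - l)"
    using root_prod_upper_triangular[OF _ ut, of n ls] sim root_prod_carrier[of T n ls]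
    by (auto simp: tr_def)
  also have "\<dots> = (\<Sum>x\<leftarrow>diag_mat T. \<Prod>l\<leftarrow>ls. x - l)"
    using sim by (simp add: diag_mat_def interv_sum_list_conv_sum_set_nat o_def atLeast0LessThan)
  also have "\<dots> = (\<Sum>x\<in>#Spec M. \<Prod>l\<leftarrow>ls. x - l)"
    using diag \<open>Spec M = mset es\<close> by (simp flip: sum_mset_sum_list mset_map)
  finally show ?thesis .
qed

subsection \<open>Intertwined Hermitian matrices\<close>

text \<open>For an eigenvector \<open>v\<close>, evaluating the form \<open>v* M v\<close> from
  either side gives the squared norm of \<open>v\<close> times \<open>x\<close> and times
  \<open>cnj x\<close>.\<close>

lemma hermitian_Spec_real:
  assumes M: "M \<in> carrier_mat n n" and herm: "adj M = M" and x: "x \<in># Spec M"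
  shows "cnj x = x"
proof -
  have "char_poly M \<noteq> 0"
    using degree_monic_char_poly[OF M] by auto
  then have "eigenvalue M x"
    using x by (simp add: Spec_def eigenvalue_root_char_poly[OF M])
  then obtain v where v: "v \<in> carrier_vec n" "v \<noteq> 0\<^sub>v n" and Mv: "M *\<^sub>v v = x \<cdot>\<^sub>v v"
    using M by (auto simp: eigenvalue_def eigenvector_def)
  \<comment> \<open>The eigenvector becomes a one-column matrix, so that the facts about
    \<open>adj\<close> and \<open>tr\<close> apply to it.\<close>
  define V where "V = mat n 1 (\<lambda>(i, j). v $ i)"
  have V: "V \<in> carrier_mat n 1"
    by (simp add: V_def)
  have MV: "M * V = x \<cdot>\<^sub>m V"
  proof (rule eq_matI)
    fix i j assume "i < dim_row (x \<cdot>\<^sub>m V)" "j < dim_col (x \<cdot>\<^sub>m V)"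
    then have ij: "i < n" "j = 0" by (auto simp: V_def)
    have "(M * V) $$ (i, j) = (M *\<^sub>v v) $ i"
      using M v ij by (auto simp: V_def scalar_prod_def intro!: sum.cong)
    then show "(M * V) $$ (i, j) = (x \<cdot>\<^sub>m V) $$ (i, j)"
      using Mv v ij by (simp add: V_def)
  qed (use M in \<open>auto simp: V_def\<close>)
  have VV: "adj V * V \<in> carrier_mat 1 1"
    using V by (auto intro!: mult_carrier_mat)
  have 1: "adj V * (M * V) = x \<cdot>\<^sub>m (adj V * V)"
    unfolding MV using V by (intro mult_smult_distrib[of _ 1 n _ 1]) auto
  have "adj V * (M * V) = adj (M * V) * V"
    using M V herm by (simp add: adj_mult[of M n n V 1] assoc_mult_mat[of _ 1 n _ n _ 1])
  also have "\<dots> = cnj x \<cdot>\<^sub>m (adj V * V)"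
    unfolding MV adj_smult using V by (intro mult_smult_assoc_mat[of _ 1 n _ 1]) auto
  finally have "x * tr (adj V * V) = cnj x * tr (adj V * V)"
    using 1 by (metis tr_smult[OF VV])
  moreover have "tr (adj V * V) \<noteq> 0"
  proof
    assume "tr (adj V * V) = 0"
    then have V0: "V = 0\<^sub>m n 1"
      by (rule tr_adj_mult_self_eq_0[OF V])
    have "v = 0\<^sub>v n"
    proof (rule eq_vecI)
      fix i assume "i < dim_vec (0\<^sub>v n :: complex vec)"
      then show "v $ i = 0\<^sub>v n $ i"
        using arg_cong[OF V0, of "\<lambda>W. W $$ (i, 0)"] by (simp add: V_def)
    qed (use v in auto)
    then show False using v by simp
  qed
  ultimately show ?thesis by simp
qed

lemma sum_mset_supported_at:
  fixes g :: "'a \<Rightarrow> 'b :: semiring_1"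
  assumes "\<And>y. y \<in># X \<Longrightarrow> y \<noteq> x \<Longrightarrow> g y = 0"
  shows "(\<Sum>y\<in>#X. g y) = of_nat (count X x) * g x"
  using assms by (induction X) (auto simp: algebra_simps)

text \<open>Up to the factor \<surd>r, \<open>Q\<close> is an isometry onto an
  \<open>M\<close>-invariant subspace on which \<open>M\<close> acts as \<open>A\<close>.\<close>

locale intertwined_matrices =
  fixes M A Q :: "complex mat" and N n r :: nat
  assumes M [simp]: "M \<in> carrier_mat N N" and A [simp]: "A \<in> carrier_mat n n"
    and Q [simp]: "Q \<in> carrier_mat N n"
    and adj_M [simp]: "adj M = M" and adj_A [simp]: "adj A = A"
    and MQ: "M * Q = Q * A"
    and QQ: "adj Q * Q = of_nat r \<cdot>\<^sub>m 1\<^sub>m n"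
    and r_pos: "r > 0"
begin

lemmas dims [simp] = carrier_matD[OF M] carrier_matD[OF A] carrier_matD[OF Q]
  root_prod_dim[OF M] root_prod_dim[OF A]

text \<open>\<open>R\<close> is \<open>r\<close> times the orthogonal projection onto the orthogonal complement of the range of \<open>Q\<close>.\<close>

definition R :: "complex mat" where
  "R = of_nat r \<cdot>\<^sub>m 1\<^sub>m N - Q * adj Q"

lemma S_carrier [simp]: "Q * adj Q \<in> carrier_mat N N"
  by (rule mult_carrier_mat[of _ N n]) simp_all

lemma Q_mult_carrier [simp]: "X \<in> carrier_mat n n \<Longrightarrow> Q * X \<in> carrier_mat N n"
  by (rule mult_carrier_mat[of _ N n]) simp_all

lemma mult_carrier [simp]:
  "X \<in> carrier_mat N N \<Longrightarrow> Y \<in> carrier_mat N N \<Longrightarrow> X * Y \<in> carrier_mat N N"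
  by (rule mult_carrier_mat)

lemma R_carrier [simp]: "R \<in> carrier_mat N N"
  unfolding R_def by (intro minus_carrier_mat) simp

lemma R_dims [simp]: "dim_row R = N" "dim_col R = N"
  using R_carrier by (rule carrier_matD)+

lemma adj_R [simp]: "adj R = R"
  by (simp add: R_def adj_minus[of _ N N] adj_smult adj_mult[of _ N n _ N])

text \<open>The intertwining relation moves \<open>X\<close> past \<open>Q\<close> as
  \<open>Y\<close>. The instances are polynomials and powers of \<open>M\<close> and
  \<open>A\<close>, and also \<open>X = R\<close> with \<open>Y = 0\<close>.\<close>

lemma mult_R:
  assumes X: "X \<in> carrier_mat N N" and Y: "Y \<in> carrier_mat n n" and XQ: "X * Q = Q * Y"
  shows "X * R = of_nat r \<cdot>\<^sub>m X - Q * Y * adj Q"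
proof -
  have "X * (Q * adj Q) = Q * Y * adj Q"
    using X by (simp add: assoc_mult_mat[of X N N Q n "adj Q" N, symmetric] XQ)
  then show ?thesis
    using X by (simp add: R_def mult_minus_distrib_mat[of _ N N _ N] mult_smult_distrib[of _ N N _ N])
qed

lemma R_mult_R: "R * R = of_nat r \<cdot>\<^sub>m R"
proof -
  have "(Q * adj Q) * Q = Q * (of_nat r \<cdot>\<^sub>m 1\<^sub>m n)"
    by (simp add: assoc_mult_mat[of Q N n "adj Q" N Q n] QQ)
  also have "\<dots> = of_nat r \<cdot>\<^sub>m Q"
    by (simp add: mult_smult_distrib[of _ N n _ n])
  \<comment> \<open>\<open>R\<close> annihilates the range of \<open>Q\<close>, so it intertwines
    with the zero matrix.\<close>
  finally have "R * Q = Q * 0\<^sub>m n n"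
    by (auto simp: R_def minus_mult_distrib_mat[of _ N N _ _ n] mult_smult_assoc_mat[of _ N N _ n])
  then have "R * R = of_nat r \<cdot>\<^sub>m R - Q * 0\<^sub>m n n * adj Q"
    by (intro mult_R) auto
  also have "\<dots> = of_nat r \<cdot>\<^sub>m R"
    by (intro eq_matI) auto
  finally show ?thesis .
qed

text \<open>The expansion \<open>r M - Q A Q*\<close> of \<open>M * R\<close> is Hermitian, hence
  \<open>M * R\<close> equals its adjoint \<open>R * M\<close>.\<close>

lemma M_mult_R: "M * R = R * M"
proof -
  have MR: "M * R = of_nat r \<cdot>\<^sub>m M - Q * A * adj Q"
    using MQ by (intro mult_R) auto
  have "adj (M * R) = R * M"
    by (simp add: adj_mult[of _ N N _ N])
  moreover have "adj (of_nat r \<cdot>\<^sub>m M - Q * A * adj Q) = of_nat r \<cdot>\<^sub>m M - Q * A * adj Q"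
  proof -
    have "adj (Q * A * adj Q) = Q * (A * adj Q)"
      by (simp add: adj_mult[of "Q * A" N n _ N] adj_mult[of Q N n A n])
    also have "\<dots> = Q * A * adj Q"
      by (simp add: assoc_mult_mat[of Q N n A n "adj Q" N])
    finally show ?thesis
      by (simp add: adj_minus[of _ N N] adj_smult mult_carrier_mat[of _ N n])
  qed
  ultimately show ?thesis using MR by metis
qed

text \<open>Cyclicity of the trace brings \<open>Q*\<close> next to \<open>Q\<close>, where their
  product is \<open>r\<close> times the identity; the pulled-back term thus has trace
  \<open>r * tr (root_prod ls A)\<close>.\<close>

lemma tr_root_prod_R:
  "tr (root_prod ls M * R) = of_nat r * (tr (root_prod ls M) - tr (root_prod ls A))"
proof -
  let ?A = "root_prod ls A"
  have "tr (Q * ?A * adj Q) = tr (adj Q * (Q * ?A))"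
    by (intro tr_comm[of _ N n]) auto
  also have "adj Q * (Q * ?A) = adj Q * Q * ?A"
    by (intro assoc_mult_mat[symmetric, of _ n N _ n _ n]) auto
  also have "\<dots> = of_nat r \<cdot>\<^sub>m ?A"
    by (simp add: QQ mult_smult_assoc_mat[of _ n n _ n])
  also have "tr \<dots> = of_nat r * tr ?A"
    by (intro tr_smult[of _ n]) auto
  finally have 1: "tr (Q * ?A * adj Q) = of_nat r * tr ?A" .
  have "root_prod ls M * R = of_nat r \<cdot>\<^sub>m root_prod ls M - Q * ?A * adj Q"
    by (intro mult_R root_prod_intertwine[of _ N _ n]) (auto simp: MQ)
  also have "tr \<dots> = tr (of_nat r \<cdot>\<^sub>m root_prod ls M) - tr (Q * ?A * adj Q)"
    by (intro tr_minus[of _ N]) (auto intro!: mult_carrier_mat[of _ N n])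
  also have "\<dots> = of_nat r * tr (root_prod ls M) - of_nat r * tr ?A"
    by (simp add: 1 tr_smult[of _ N])
  finally show ?thesis by (simp add: algebra_simps)
qed

text \<open>\<open>R\<close> is Hermitian and commutes with polynomials in \<open>M\<close>, so the
  norm reduces to the trace of one polynomial in \<open>M\<close> times \<open>R\<close>. One factor
  \<open>r\<close> comes from \<open>R * R\<close>, the other from
  \<open>tr_root_prod_R\<close>.\<close>

lemma tr_adj_root_prod_R:
  defines "g \<equiv> \<lambda>ls x :: complex. (cmod (\<Prod>l\<leftarrow>ls. x - l))\<^sup>2"
  shows "tr (adj (root_prod ls M * R) * (root_prod ls M * R)) =
    of_real (of_nat r * of_nat r * ((\<Sum>x\<in>#Spec M. g ls x) - (\<Sum>x\<in>#Spec A. g ls x)))"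
proof -
  \<comment> \<open>\<open>?ls'\<close> holds the roots of the conjugate polynomial, in the order in
    which the adjoint produces them.\<close>
  let ?P = "root_prod ls M" and ?ls' = "rev (map cnj ls)"
  let ?P' = "root_prod ?ls' M"
  have tr_g: "tr (root_prod (ls @ ?ls') X) = of_real (\<Sum>x\<in>#Spec X. g ls x)"
    if "X \<in> carrier_mat k k" "adj X = X" for X k
  proof -
    have "(\<Prod>l\<leftarrow>ls @ ?ls'. x - l) = of_real (g ls x)" if "x \<in># Spec X" for x
    proof -
      \<comment> \<open>Only for real \<open>x\<close> is \<open>x - cnj l\<close> the conjugate of
        \<open>x - l\<close>; then the product over \<open>ls @ ?ls'\<close> is a squared
        modulus.\<close>
      have x: "cnj x = x"
        using hermitian_Spec_real \<open>X \<in> _\<close> \<open>adj X = X\<close> that by blast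
      have "(\<Prod>l\<leftarrow>?ls'. x - l) = cnj (\<Prod>l\<leftarrow>ls. x - l)"
        by (induction ls) (auto simp: x mult.commute)
      then show ?thesis
        by (simp add: g_def complex_norm_square del: of_real_power)
    qed
    then have "(\<Sum>x\<in>#Spec X. \<Prod>l\<leftarrow>ls @ ?ls'. x - l) = (\<Sum>x\<in>#Spec X. of_real (g ls x))"
      by (intro arg_cong[of _ _ sum_mset] image_mset_cong) auto
    also have "(\<Sum>x\<in>#Z. complex_of_real (g ls x)) = of_real (\<Sum>x\<in>#Z. g ls x)" for Z
      by (induction Z) auto
    finally show ?thesis
      unfolding tr_root_prod[OF \<open>X \<in> _\<close>] .
  qed
  have RP': "?P' * R = R * ?P'"
    by (intro root_prod_intertwine[of _ N _ N]) (auto simp: M_mult_R)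
  have PR: "?P * R \<in> carrier_mat N N"
    by simp
  have "adj (?P * R) = R * ?P'"
    by (simp add: adj_mult[of _ N N _ N] adj_root_prod[of _ N])
  then have "tr (adj (?P * R) * (?P * R)) = tr (?P * R * (R * ?P'))"
    using PR by (simp add: tr_comm[of "R * ?P'" N N])
  also have "?P * R * (R * ?P') = ?P * (R * R * ?P')"
    by (simp add: assoc_mult_mat[of _ N N _ N _ N] mult_carrier_mat[of _ N N])
  also have "R * R * ?P' = of_nat r \<cdot>\<^sub>m (?P' * R)"
    by (simp add: R_mult_R RP' mult_smult_assoc_mat[of _ N N _ N])
  also have "?P * (of_nat r \<cdot>\<^sub>m (?P' * R)) = of_nat r \<cdot>\<^sub>m (?P * (?P' * R))"
    by (intro mult_smult_distrib[of _ N N _ N]) (auto intro!: mult_carrier_mat)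
  also have "?P * (?P' * R) = root_prod (ls @ ?ls') M * R"
    by (simp add: root_prod_append[of _ N] assoc_mult_mat[of _ N N _ N _ N])
  also have "tr (of_nat r \<cdot>\<^sub>m (root_prod (ls @ ?ls') M * R)) =
      of_nat r * tr (root_prod (ls @ ?ls') M * R)"
    by (intro tr_smult[of _ N] mult_carrier_mat) auto
  also have "\<dots> = of_nat r * (of_nat r * (tr (root_prod (ls @ ?ls') M) - tr (root_prod (ls @ ?ls') A)))"
    by (simp only: tr_root_prod_R)
  also have "\<dots> = of_real (of_nat r * of_nat r * ((\<Sum>x\<in>#Spec M. g ls x) - (\<Sum>x\<in>#Spec A. g ls x)))"
    by (simp only: tr_g[OF M adj_M] tr_g[OF A adj_A] of_real_mult of_real_diff of_real_of_nat_eq mult.assoc)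
  finally show ?thesis .
qed

section \<open>Comparison of the two spectra\<close>

lemma Spec_subset: "Spec A \<subseteq># Spec M"
proof (rule mset_subset_eqI)
  fix x
  \<comment> \<open>With \<open>ls\<close> running through all other eigenvalues, the squared Frobenius norm of
    \<open>root_prod ls M * R\<close> is a positive multiple of the multiplicity difference at \<open>x\<close>.\<close>
  obtain ls where ls: "set ls = (set_mset (Spec M) \<union> set_mset (Spec A)) - {x}"
    using finite_list[of "(set_mset (Spec M) \<union> set_mset (Spec A)) - {x}"] by auto
  define g where "g = (\<lambda>y. (cmod (\<Prod>l\<leftarrow>ls. y - l))\<^sup>2)"
  have g0: "g y = 0" if "y \<in> set ls" for y
    using that by (auto simp: g_def prod_list_zero_iff)
  have "g x > 0"
  proof -
    have "x \<notin> set ls" using ls by blast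
    then show ?thesis by (auto simp: g_def prod_list_zero_iff)
  qed
  have sums: "(\<Sum>y\<in>#Spec X. g y) = of_nat (count (Spec X) x) * g x" if "X = M \<or> X = A" for X
    using that ls by (intro sum_mset_supported_at g0) auto
  define D where "D = root_prod ls M * R"
  have D: "D \<in> carrier_mat N N"
    unfolding D_def by simp
  have "complex_of_real (of_nat r * of_nat r * ((\<Sum>y\<in>#Spec M. g y) - (\<Sum>y\<in>#Spec A. g y))) =
      of_real (\<Sum>j<N. \<Sum>i<N. (cmod (D $$ (i, j)))\<^sup>2)"
    using tr_adj_root_prod_R[of ls] tr_adj_mult_self[OF D] unfolding D_def g_def by metis
  then have "of_nat r * of_nat r * ((\<Sum>y\<in>#Spec M. g y) - (\<Sum>y\<in>#Spec A. g y)) \<ge> 0"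
    unfolding of_real_eq_iff by (simp add: sum_nonneg)
  then have "(\<Sum>y\<in>#Spec A. g y) \<le> (\<Sum>y\<in>#Spec M. g y)"
    using mult_pos_pos[of "real r" "real r"] r_pos unfolding zero_le_mult_iff by linarith
  then show "count (Spec A) x \<le> count (Spec M) x"
    using \<open>g x > 0\<close> by (simp add: sums)
qed

text \<open>In the norm formula the eigenvalues of \<open>A\<close> cancel and every new eigenvalue
  contributes zero, so the Frobenius norm vanishes.\<close>

lemma root_prod_R_eq_0:
  assumes "set_mset (Spec M - Spec A) \<subseteq> set ls"
  shows "root_prod ls M * R = 0\<^sub>m N N"
proof -
  define E where "E = Spec M - Spec A"
  \<comment> \<open>Multiset difference truncates; containment of the spectra is what makes this an
    equation.\<close>
  have E: "Spec M = Spec A + E"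
    using Spec_subset by (simp add: E_def)
  have "(\<Sum>x\<in>#E. (cmod (\<Prod>l\<leftarrow>ls. x - l))\<^sup>2) = 0"
    using assms by (intro sum_mset.neutral) (auto simp: E_def prod_list_zero_iff)
  then have "tr (adj (root_prod ls M * R) * (root_prod ls M * R)) = 0"
    by (simp add: tr_adj_root_prod_R E)
  then show ?thesis
    by (intro tr_adj_mult_self_eq_0) simp_all
qed

section \<open>Powers of \<open>M\<close> and their diagonals\<close>

lemma pow_R: "M ^\<^sub>m k * R = of_nat r \<cdot>\<^sub>m M ^\<^sub>m k - Q * A ^\<^sub>m k * adj Q"
proof (rule mult_R)
  show "M ^\<^sub>m k * Q = Q * A ^\<^sub>m k"
  proof (induction k)
    case (Suc k)
    have "M ^\<^sub>m Suc k * Q = M ^\<^sub>m k * Q * A"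
      by (simp add: assoc_mult_mat[of _ N N _ N _ n] assoc_mult_mat[of _ N N _ n _ n] MQ)
    then show ?case
      by (simp add: Suc.IH assoc_mult_mat[of _ N n _ n _ n])
  qed auto
qed (auto intro: pow_carrier_mat)

text \<open>The relation \<open>(M - \<theta>) (M - \<tau>) R = 0\<close> expresses
  \<open>M * (M * R)\<close> through \<open>M * R\<close> and \<open>R\<close>, so each further
  power stays in their span.\<close>

lemma pow_R_linear:
  assumes "set_mset (Spec M - Spec A) \<subseteq> {\<theta>, \<tau>}"
  shows "\<exists>a b. M ^\<^sub>m k * R = a \<cdot>\<^sub>m (M * R) + b \<cdot>\<^sub>m R"
proof (induction k)
  case 0
  show ?case
    by (intro exI[of _ 0] exI[of _ 1] eq_matI) auto
next
  case (Suc k)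
  then obtain a b where ab: "M ^\<^sub>m k * R = a \<cdot>\<^sub>m (M * R) + b \<cdot>\<^sub>m R" by blast
  have carr [simp]: "M ^\<^sub>m k \<in> carrier_mat N N"
    by (simp add: pow_carrier_mat)
  have "root_prod [\<theta>, \<tau>] M * R = 0\<^sub>m N N"
    using assms by (intro root_prod_R_eq_0) auto
  also have "root_prod [\<theta>, \<tau>] M * R =
      (M - \<theta> \<cdot>\<^sub>m 1\<^sub>m N) * ((M - \<tau> \<cdot>\<^sub>m 1\<^sub>m N) * R)"
    by (simp add: assoc_mult_mat[of _ N N _ N _ N] minus_carrier_mat)
  also have "\<dots> = M * (M * R) - \<theta> \<cdot>\<^sub>m (M * R) - \<tau> \<cdot>\<^sub>m (M * R - \<theta> \<cdot>\<^sub>m R)"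
    by (simp add: minus_mult_distrib_mat[of _ N N _ _ N] mult_minus_distrib_mat[of _ N N _ N]
        mult_smult_assoc_mat[of _ N N _ N] mult_smult_distrib[of _ N N _ N] minus_carrier_mat)
  finally have 0: "M * (M * R) - \<theta> \<cdot>\<^sub>m (M * R) - \<tau> \<cdot>\<^sub>m (M * R - \<theta> \<cdot>\<^sub>m R) = 0\<^sub>m N N" .
  have quad: "(M * (M * R)) $$ (i, j) = (\<theta> + \<tau>) * (M * R) $$ (i, j) - \<theta> * \<tau> * R $$ (i, j)"
    if ij: "i < N" "j < N" for i j
    using arg_cong[OF 0, of "\<lambda>X. X $$ (i, j)"] ij
    by (simp add: algebra_simps del: index_mult_mat(1))
  have "M ^\<^sub>m Suc k * R = M ^\<^sub>m k * R * M"
    by (simp add: assoc_mult_mat[of _ N N _ N _ N] M_mult_R)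
  also have "\<dots> = a \<cdot>\<^sub>m (M * (M * R)) + b \<cdot>\<^sub>m (M * R)"
    by (simp add: ab add_mult_distrib_mat[of _ N N _ _ N] mult_smult_assoc_mat[of _ N N _ N]
        assoc_mult_mat[of _ N N _ N _ N] M_mult_R[symmetric])
  also have "\<dots> = (a * (\<theta> + \<tau>) + b) \<cdot>\<^sub>m (M * R) + (- a * \<theta> * \<tau>) \<cdot>\<^sub>m R"
    by (intro eq_matI) (simp_all add: quad algebra_simps del: index_mult_mat(1))
  finally show ?case by blast
qed

text \<open>This is the diagonal of \<open>pow_R_linear\<close> with every \<open>R\<close>
  expanded. The coefficients \<open>a\<close> and \<open>b\<close> may depend on \<open>k\<close>
  but not on \<open>i\<close>.\<close>

lemma diag_pow:
  assumes "set_mset (Spec M - Spec A) \<subseteq> {\<theta>, \<tau>}"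
  shows "\<exists>a b. \<forall>i<N. of_nat r * (M ^\<^sub>m k) $$ (i, i) =
    (Q * A ^\<^sub>m k * adj Q) $$ (i, i)
    + a * (of_nat r * M $$ (i, i) - (Q * A * adj Q) $$ (i, i))
    + b * (of_nat r - (Q * adj Q) $$ (i, i))"
proof -
  obtain a b where ab: "M ^\<^sub>m k * R = a \<cdot>\<^sub>m (M * R) + b \<cdot>\<^sub>m R"
    using pow_R_linear[OF assms] by blast
  have MR: "M * R = of_nat r \<cdot>\<^sub>m M - Q * A * adj Q"
    using MQ by (intro mult_R) auto
  have carr: "M ^\<^sub>m k \<in> carrier_mat N N" "Q * A ^\<^sub>m k * adj Q \<in> carrier_mat N N"
    "Q * A * adj Q \<in> carrier_mat N N"
    by (auto intro!: mult_carrier_mat[of _ N n] pow_carrier_mat simp del: mult_carrier)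
  have "of_nat r * (M ^\<^sub>m k) $$ (i, i) - (Q * A ^\<^sub>m k * adj Q) $$ (i, i) =
      a * (of_nat r * M $$ (i, i) - (Q * A * adj Q) $$ (i, i))
      + b * (of_nat r - (Q * adj Q) $$ (i, i))" if "i < N" for i
    using arg_cong[OF ab, of "\<lambda>X. X $$ (i, i)"] that
      carrier_matD[OF carr(1)] carrier_matD[OF carr(2)] carrier_matD[OF carr(3)]
    unfolding pow_R MR by (simp add: R_def del: index_mult_mat(1))
  then show ?thesis
    by (intro exI[of _ a] exI[of _ b] allI impI) (simp add: algebra_simps)
qed

end

subsection \<open>The adjacency matrix of a cover\<close>

lemma vertex_list:
  assumes "finite (pverts Y)"
  shows "distinct (vertex_list Y)" "set (vertex_list Y) = pverts Y"
proof -
  have "\<exists>vs. distinct vs \<and> set vs = pverts Y"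
    using finite_distinct_list[OF assms] by blast
  then have "distinct (vertex_list Y) \<and> set (vertex_list Y) = pverts Y"
    unfolding vertex_list_def by (rule someI_ex)
  then show "distinct (vertex_list Y)" "set (vertex_list Y) = pverts Y" by auto
qed

lemma adjacency_matrix_carrier:
  "adjacency_matrix Y \<in> carrier_mat (length (vertex_list Y)) (length (vertex_list Y))"
  by (simp add: adjacency_matrix_def Let_def)

lemma adjacency_matrix_index:
  assumes "i < length (vertex_list Y)" "j < length (vertex_list Y)"
  shows "adjacency_matrix Y $$ (i, j) =
    (if (vertex_list Y ! i, vertex_list Y ! j) \<in> parcs Y then 1 else 0)"
  using assms by (simp add: adjacency_matrix_def Let_def)

lemma adj_adjacency_matrix:
  assumes "\<And>u v. (u, v) \<in> parcs Y \<Longrightarrow> (v, u) \<in> parcs Y"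
  shows "adj (adjacency_matrix Y) = adjacency_matrix Y"
  using assms adjacency_matrix_carrier[of Y]
  by (intro eq_matI) (auto simp: adjacency_matrix_index)

lemma sum_nth_distinct:
  assumes "distinct vs"
  shows "(\<Sum>i<length vs. h (vs ! i)) = (\<Sum>v\<in>set vs. h v)"
  using sum.reindex_bij_betw[OF bij_betw_nth[OF assms refl refl], of h] .

text \<open>The arc function is restated with plain permutations of \<open>{1..r}\<close> and the
  inverse function \<open>inv'\<close> in place of the inverse in
  \<open>sym_group r\<close>.\<close>

locale symmetric_cover =
  fixes Y :: "'v pair_pre_digraph" and r :: nat and f :: "'v arc_function"
  assumes pair_graph: "pair_graph Y"
    and f_None: "\<And>u v. u \<in> pverts Y \<Longrightarrow> v \<in> pverts Y \<Longrightarrow> f u v = None \<longleftrightarrow> (u, v) \<notin> parcs Y"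
    and f_permutes: "\<And>u v g. u \<in> pverts Y \<Longrightarrow> v \<in> pverts Y \<Longrightarrow> f u v = Some g \<Longrightarrow> g permutes {1..r}"
    and f_sym: "\<And>u v g. u \<in> pverts Y \<Longrightarrow> v \<in> pverts Y \<Longrightarrow> f u v = Some g \<Longrightarrow> f v u = Some (inv' g)"
    and r_pos: "r > 0"
begin

interpretation Y: pair_graph Y by (rule pair_graph)

lemma arc_vertices: "(u, v) \<in> parcs Y \<Longrightarrow> u \<in> pverts Y \<and> v \<in> pverts Y"
  using Y.in_arcsD1 Y.in_arcsD2 by blast

lemma arc_sym: "(u, v) \<in> parcs Y \<Longrightarrow> (v, u) \<in> parcs Y"
  using Y.pair_sym_arcs by (auto simp: symmetric_def dest: symD)

lemma no_loop: "(v, v) \<notin> parcs Y"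
  using Y.pair_no_loops[of "(v, v)"] by auto

lemma cover_sym:
  assumes "(p, q) \<in> parcs (cover Y r f)"
  shows "(q, p) \<in> parcs (cover Y r f)"
proof -
  from assms obtain v j u k g where p: "p = (v, j)" "q = (u, k)" "j \<in> {1..r}" "k \<in> {1..r}"
    "(v, u) \<in> parcs Y" "f u v = Some g" "g j = k"
    by (auto simp: cover_def)
  moreover have "(inv' g) k = j"
    using f_permutes[of u v g] p arc_vertices by (auto simp: permutes_inverses)
  ultimately show ?thesis
    using f_sym[of u v g] arc_vertices[of v u] arc_sym[of v u] by (auto simp: cover_def)
qed

text \<open>The covering property: an arc from \<open>v\<close> to \<open>u\<close> has exactly one
  lift starting at \<open>(v, j)\<close>, and it ends at \<open>(u, g j)\<close>.\<close>

lemma card_lifts: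
  assumes j: "j \<in> {1..r}"
  shows "(\<Sum>k\<in>{1..r}. if ((v, j), (u, k)) \<in> parcs (cover Y r f) then 1 else (0 :: complex)) =
    (if (v, u) \<in> parcs Y then 1 else 0)"
proof (cases "(v, u) \<in> parcs Y")
  case True
  then obtain g where g: "f u v = Some g"
    using f_None[of u v] arc_vertices[of v u] arc_sym[of v u] by auto
  then have "g j \<in> {1..r}"
    using f_permutes[of u v g] arc_vertices[OF True] j by (auto simp only: permutes_in_image)
  moreover have "((v, j), (u, k)) \<in> parcs (cover Y r f) \<longleftrightarrow> k = g j" if "k \<in> {1..r}" for k
    using True g j that by (auto simp: cover_def)
  then have "(\<Sum>k\<in>{1..r}. if ((v, j), (u, k)) \<in> parcs (cover Y r f) then 1 else (0 :: complex)) =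
      (\<Sum>k\<in>{1..r}. if k = g j then 1 else 0)"
    by (intro sum.cong) auto
  ultimately show ?thesis using True by simp
qed (simp add: cover_def)

section \<open>The fibres and their characteristic matrix\<close>

abbreviation "X \<equiv> cover Y r f"
abbreviation "xs \<equiv> vertex_list X"
abbreviation "ys \<equiv> vertex_list Y"

lemma xs: "distinct xs" "set xs = pverts Y \<times> {1..r}"
  using vertex_list[of X] Y.pair_finite_verts by (simp_all add: cover_def)

lemma ys: "distinct ys" "set ys = pverts Y"
  using vertex_list[of Y] Y.pair_finite_verts by simp_all

text \<open>The characteristic matrix of the partition of the cover into fibres: column
  \<open>a\<close> is the indicator of the fibre over \<open>ys ! a\<close>.\<close>

definition Q :: "complex mat" where
  "Q = mat (length xs) (length ys) (\<lambda>(i, a). if fst (xs ! i) = ys ! a then 1 else 0)"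

lemma Q_carrier: "Q \<in> carrier_mat (length xs) (length ys)"
  by (simp add: Q_def)

lemma Q_index:
  "i < length xs \<Longrightarrow> a < length ys \<Longrightarrow> Q $$ (i, a) = (if fst (xs ! i) = ys ! a then 1 else 0)"
  by (simp add: Q_def)

lemma vertex_in_fibre:
  assumes "i < length xs"
  obtains a j where "a < length ys" "xs ! i = (ys ! a, j)" "j \<in> {1..r}"
proof -
  have "xs ! i \<in> pverts Y \<times> {1..r}"
    using assms xs(2) nth_mem by blast
  then obtain v j where "xs ! i = (v, j)" "v \<in> set ys" "j \<in> {1..r}"
    using ys(2) by auto
  then show thesis
    using that by (auto simp: in_set_conv_nth)
qed

text \<open>Row \<open>i\<close> of \<open>Q\<close> is the unit vector at the base vertex below
  \<open>xs ! i\<close>, so multiplication by \<open>Q\<close> copies row \<open>a\<close> of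
  \<open>B\<close>.\<close>

lemma Q_mult_index:
  assumes "i < length xs" "a < length ys" "fst (xs ! i) = ys ! a"
    and B: "B \<in> carrier_mat (length ys) m" and "b < m"
  shows "(Q * B) $$ (i, b) = B $$ (a, b)"
proof -
  have "Q $$ (i, c) * B $$ (c, b) = (if c = a then B $$ (a, b) else 0)" if "c < length ys" for c
    using assms that ys(1) by (auto simp: Q_index nth_eq_iff_index_eq)
  then show ?thesis
    using assms by (subst index_mult_mat_sum[OF Q_carrier B]) simp_all
qed

lemma Q_adj_Q_diag:
  assumes "i < length xs" "a < length ys" "fst (xs ! i) = ys ! a"
    and B: "B \<in> carrier_mat (length ys) (length ys)"
  shows "(Q * B * adj Q) $$ (i, i) = B $$ (a, a)"
proof -
  have QB: "Q * B \<in> carrier_mat (length xs) (length ys)"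
    using Q_carrier B by (rule mult_carrier_mat)
  have "(Q * B) $$ (i, c) * adj Q $$ (c, i) = (if c = a then B $$ (a, a) else 0)"
    if "c < length ys" for c
    using assms that ys(1) carrier_matD[OF Q_carrier] Q_mult_index[OF assms(1-3) B that]
    by (auto simp: Q_index nth_eq_iff_index_eq simp del: index_mult_mat(1))
  then show ?thesis
    using assms Q_carrier
    by (subst index_mult_mat_sum[OF QB, of _ "length xs"]) (simp_all del: index_mult_mat(1))
qed

text \<open>The left entry counts the neighbours of \<open>xs ! i\<close> in the fibre over
  \<open>ys ! a\<close>. By unique lifting this is the adjacency entry of the base vertices, which
  the right side reads off.\<close>

lemma intertwine: "adjacency_matrix X * Q = Q * adjacency_matrix Y"
proof (rule eq_matI)
  fix i a
  assume "i < dim_row (Q * adjacency_matrix Y)" "a < dim_col (Q * adjacency_matrix Y)"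
  then have i: "i < length xs" and a: "a < length ys"
    using carrier_matD[OF Q_carrier] carrier_matD[OF adjacency_matrix_carrier[of Y]] by auto
  obtain b j where b: "b < length ys" "xs ! i = (ys ! b, j)" "j \<in> {1..r}"
    using vertex_in_fibre[OF i] by blast
  let ?e = "\<lambda>p. if (xs ! i, p) \<in> parcs X then 1 else 0 :: complex"
  have "(adjacency_matrix X * Q) $$ (i, a) =
      (\<Sum>i'<length xs. ?e (xs ! i') * (if fst (xs ! i') = ys ! a then 1 else 0))"
    using i a by (subst index_mult_mat_sum[OF adjacency_matrix_carrier Q_carrier])
      (auto simp: adjacency_matrix_index Q_index intro!: sum.cong)
  also have "\<dots> = (\<Sum>p\<in>pverts Y \<times> {1..r}. ?e p * (if fst p = ys ! a then 1 else 0))"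
    using sum_nth_distinct[OF xs(1), of "\<lambda>p. ?e p * (if fst p = ys ! a then 1 else 0)"]
    by (simp only: xs(2))
  also have "\<dots> = (\<Sum>v\<in>pverts Y. \<Sum>k\<in>{1..r}. ?e (v, k) * (if v = ys ! a then 1 else 0))"
    by (simp only: sum.cartesian_product case_prod_unfold prod.collapse fst_conv)
  also have "\<dots> = (\<Sum>v\<in>pverts Y. if v = ys ! a then \<Sum>k\<in>{1..r}. ?e (ys ! a, k) else 0)"
    by (intro sum.cong refl) auto
  also have "\<dots> = (\<Sum>k\<in>{1..r}. ?e (ys ! a, k))"
    using Y.pair_finite_verts nth_mem[OF a] ys(2) by simp
  also have "\<dots> = (if (ys ! b, ys ! a) \<in> parcs Y then 1 else 0)"
    unfolding b(2) by (rule card_lifts[OF b(3)])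
  also have "\<dots> = (Q * adjacency_matrix Y) $$ (i, a)"
    using i a b by (subst Q_mult_index[OF i b(1) _ adjacency_matrix_carrier])
      (auto simp: adjacency_matrix_index)
  finally show "(adjacency_matrix X * Q) $$ (i, a) = (Q * adjacency_matrix Y) $$ (i, a)" .
qed (use Q_carrier adjacency_matrix_carrier[of X] adjacency_matrix_carrier[of Y] in auto)

text \<open>Distinct fibres are disjoint, and each has \<open>r\<close> vertices.\<close>

lemma adj_Q_mult_Q: "adj Q * Q = of_nat r \<cdot>\<^sub>m 1\<^sub>m (length ys)"
proof (rule eq_matI)
  fix a b
  assume "a < dim_row (of_nat r \<cdot>\<^sub>m 1\<^sub>m (length ys))" "b < dim_col (of_nat r \<cdot>\<^sub>m 1\<^sub>m (length ys))"
  then have a: "a < length ys" and b: "b < length ys" by auto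
  let ?h = "\<lambda>p. if fst p = ys ! a \<and> fst p = ys ! b then 1 else 0 :: complex"
  have "adj Q \<in> carrier_mat (length ys) (length xs)"
    using Q_carrier by simp
  then have "(adj Q * Q) $$ (a, b) = (\<Sum>i<length xs. ?h (xs ! i))"
    using a b carrier_matD[OF Q_carrier] by (subst index_mult_mat_sum[OF _ Q_carrier])
      (auto simp: Q_index intro!: sum.cong)
  also have "\<dots> = (\<Sum>p\<in>pverts Y \<times> {1..r}. ?h p)"
    using sum_nth_distinct[OF xs(1), of ?h] by (simp only: xs(2))
  also have "\<dots> = (\<Sum>v\<in>pverts Y. \<Sum>k\<in>{1..r}. ?h (v, k))"
    by (simp only: sum.cartesian_product case_prod_unfold prod.collapse fst_conv)
  also have "\<dots> = (\<Sum>v\<in>pverts Y. if v = ys ! a then (if a = b then of_nat r else 0) else 0)"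
    using a b ys(1) by (intro sum.cong refl) (auto simp: nth_eq_iff_index_eq)
  also have "\<dots> = (of_nat r \<cdot>\<^sub>m 1\<^sub>m (length ys)) $$ (a, b)"
    using Y.pair_finite_verts nth_mem[OF a] ys(2) a b by simp
  finally show "(adj Q * Q) $$ (a, b) = (of_nat r \<cdot>\<^sub>m 1\<^sub>m (length ys)) $$ (a, b)" .
qed (use Q_carrier in auto)

sublocale intertwined_matrices "adjacency_matrix X" "adjacency_matrix Y" Q "length xs" "length ys" r
  by unfold_locales (auto simp: adjacency_matrix_carrier Q_carrier intertwine adj_Q_mult_Q r_pos
      intro!: adj_adjacency_matrix arc_sym cover_sym)

lemma walk_regular_cover:
  assumes wr: "walk_regular Y" and "two_ev_cover Y r f"
  shows "walk_regular X"
  unfolding walk_regular_def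
proof (intro allI impI)
  fix k :: nat
  assume k: "k > 0"
  obtain c where c: "\<And>a. a < length ys \<Longrightarrow> (adjacency_matrix Y ^\<^sub>m k) $$ (a, a) = c"
    using wr k carrier_matD[OF adjacency_matrix_carrier[of Y]] unfolding walk_regular_def by metis
  obtain \<theta> \<tau> where
    "set_mset (Spec (adjacency_matrix X) - Spec (adjacency_matrix Y)) = {\<theta>, \<tau>}"
    using assms(2) unfolding two_ev_cover_def card_2_iff by blast
  from diag_pow[OF equalityD1[OF this], of k] obtain a b where
    ab: "\<And>i. i < length xs \<Longrightarrow> of_nat r * (adjacency_matrix X ^\<^sub>m k) $$ (i, i) =
      (Q * adjacency_matrix Y ^\<^sub>m k * adj Q) $$ (i, i)
      + a * (of_nat r * adjacency_matrix X $$ (i, i) - (Q * adjacency_matrix Y * adj Q) $$ (i, i))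
      + b * (of_nat r - (Q * adj Q) $$ (i, i))"
    by blast
  \<comment> \<open>The value comes from solving \<open>r * x = c + b * (r - 1)\<close> for
    \<open>x\<close>. The term with \<open>a\<close> drops out because neither graph has loops: a
    loop of the cover would project to a loop of \<open>Y\<close>.\<close>
  have "(adjacency_matrix X ^\<^sub>m k) $$ (i, i) = (c + b * (of_nat r - 1)) / of_nat r"
    if i: "i < length xs" for i
  proof -
    obtain v j where v: "v < length ys" "xs ! i = (ys ! v, j)"
      using vertex_in_fibre[OF i] by blast
    note diag = Q_adj_Q_diag[OF i v(1)]
    have "adjacency_matrix X $$ (i, i) = 0" "adjacency_matrix Y $$ (v, v) = 0"
      using i v by (auto simp: adjacency_matrix_index no_loop cover_def)
    moreover have "(Q * adjacency_matrix Y ^\<^sub>m k * adj Q) $$ (i, i) = c"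
      using v c by (subst diag) (auto intro: pow_carrier_mat adjacency_matrix_carrier)
    moreover have "(Q * adjacency_matrix Y * adj Q) $$ (i, i) = adjacency_matrix Y $$ (v, v)"
      using v by (subst diag) (auto intro: adjacency_matrix_carrier)
    moreover have "(Q * adj Q) $$ (i, i) = 1"
      using diag[of "1\<^sub>m (length ys)"] v right_mult_one_mat[OF Q_carrier] by simp
    ultimately have "of_nat r * (adjacency_matrix X ^\<^sub>m k) $$ (i, i) = c + b * (of_nat r - 1)"
      using ab[OF i] by simp
    then show ?thesis
      using r_pos by (simp add: field_simps)
  qed
  then show "\<exists>c. \<forall>i<dim_row (adjacency_matrix X). (adjacency_matrix X ^\<^sub>m k) $$ (i, i) = c"
    using carrier_matD[OF adjacency_matrix_carrier[of X]] by auto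
qed

end

theorem corollary5p2:
  fixes Y :: "'v pair_pre_digraph"
    and r :: nat
    and G :: "(nat \<Rightarrow> nat) set"
    and f :: "'v arc_function"
  assumes "pair_graph Y"
    and "Digraph_Component.connected (with_proj Y)"
    and "subgroup G (sym_group r)"
    and "symmetric_arc_function Y r G f"
    and "normalized Y f"
    and "acts_regularly (arc_function_group Y r f) r"
    and "walk_regular Y"
    and "abelian_cover Y r f"
    and "two_ev_cover Y r f"
  shows "walk_regular (cover Y r f)"
proof (cases "r = 0")
  \<comment> \<open>For \<open>r = 0\<close> the cover has no vertices and the diagonal condition is
    vacuous; otherwise division by \<open>r\<close> is possible.\<close>
  case True
  then have "pverts (cover Y r f) = {}"
    by (simp add: cover_def)
  then have "vertex_list (cover Y r f) = []"
    using vertex_list(2)[of "cover Y r f"] by simp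
  then show ?thesis
    using carrier_matD(1)[OF adjacency_matrix_carrier[of "cover Y r f"]]
    by (simp add: walk_regular_def)
next
  case False
  have G: "g \<in> carrier (sym_group r)" if "g \<in> G" for g
    using that subgroup.subset[OF assms(3)] by blast
  interpret symmetric_cover Y r f
  proof (rule symmetric_cover.intro)
    fix u v g
    assume uv: "u \<in> pverts Y" "v \<in> pverts Y"
    show "f u v = None \<longleftrightarrow> (u, v) \<notin> parcs Y"
      using assms(4) uv unfolding symmetric_arc_function_def by blast
    assume "f u v = Some g"
    then have "g \<in> G" "f v u = Some (inv\<^bsub>sym_group r\<^esub> g)"
      using assms(4) uv unfolding symmetric_arc_function_def by blast+
    then show "g permutes {1..r}" "f v u = Some (inv' g)"
      using G sym_group_carrier by auto
  qed (use assms(1) False in auto)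
  show ?thesis
    using walk_regular_cover assms by blast
qed

end
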